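(* Given any agent profile $\mathbf r=(r_1,\dots,r_n)$, a location $y^*\in[0,1]$ is an optimal facility location for the social cost (i.e. $\mathrm{SC}(y^*,\mathbf r)=\min_{z\in[0,1]}\mathrm{SC}(z,\mathbf r)$) if and only if $y^*\in[y_l,y_r]$.
   Context: Setting. $N=\{1,\dots,n\}$ is a set of agents, $I=[0,1]$, $[m]=\{1,\dots,m\}$ indexes groups. Agent $i$ has a profile $r_i=(x_i,g_i)$ with location $x_i\in I$ and group $g_i\in[m]$; $\mathbf r=(r_1,\dots,r_n)$. $G_j=\{i\in N: g_i=j\}$. $d(a,b)=|a-b|$. Each group $j$ has an externality factor $\alpha_j\ge 0$. If the facility is at $y\in I$, the cost of agent $i$ is $$c_i(y,\mathbf r)=d(y,x_i)+\alpha_{g_i}\sum_{k\in G_{g_i}\setminus\{i\}}(1-d(y,x_k)).$$ Standing assumption: $\alpha_j\le 1/(|G_j|-1)$ for each group $j$ (void if $|G_j|\le 1$). Social cost: $\mathrm{SC}(y,\mathbf r)=\sum_{i\in N}c_i(y,\mathbf r)$. Let $w_i=1-\alpha_{g_i}(|G_{g_i}|-1)$. For $y\in I$ let $L(y)=\{i\in N:x_i\le y\}$ and $R(y)=\{i\in N:x_i>y\}$. Define $$Y_1=\Big\{y\in I:\sum_{i\in L(y)}w_i<\sum_{i\in R(y)}w_i\Big\},\qquad Y_2=\Big\{y\in I:\sum_{i\in L(y)}w_i>\sum_{i\in R(y)}w_i\Big\},$$ $y_l=\sup Y_1$ and $y_r=\inf Y_2$, where supremum and infimum are taken in the ordered set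 $I=[0,1]$ (so $\sup\emptyset=0$ and $\inf\emptyset=1$). *)

theory Defs
  imports Complex_Main
begin

type_synonym profile = "nat \<Rightarrow> real \<times> nat"

abbreviation loc :: "profile \<Rightarrow> nat \<Rightarrow> real" where
  "loc r i \<equiv> fst (r i)"

abbreviation grp :: "profile \<Rightarrow> nat \<Rightarrow> nat" where
  "grp r i \<equiv> snd (r i)"

definition agents :: "nat \<Rightarrow> nat set" where
  "agents n = {1..n}"

definition members :: "nat \<Rightarrow> profile \<Rightarrow> nat \<Rightarrow> nat set" where
  "members n r j = {i \<in> agents n. grp r i = j}"

definition valid_profile :: "nat \<Rightarrow> nat \<Rightarrow> profile \<Rightarrow> bool" where
  "valid_profile n m r \<longleftrightarrow> (\<forall>i\<in>agents n. loc r i \<in> {0..1} \<and> grp r i \<in> {1..m})"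

definition valid_factors :: "nat \<Rightarrow> nat \<Rightarrow> profile \<Rightarrow> (nat \<Rightarrow> real) \<Rightarrow> bool" where
  "valid_factors n m r \<alpha> \<longleftrightarrow>
     (\<forall>j\<in>{1..m}. \<alpha> j \<ge> 0 \<and>
        (card (members n r j) > 1 \<longrightarrow> \<alpha> j \<le> 1 / (real (card (members n r j)) - 1)))"

definition cost :: "nat \<Rightarrow> (nat \<Rightarrow> real) \<Rightarrow> profile \<Rightarrow> nat \<Rightarrow> real \<Rightarrow> real" where
  "cost n \<alpha> r i y =
     dist y (loc r i) +
     \<alpha> (grp r i) * (\<Sum>k\<in>members n r (grp r i) - {i}. 1 - dist y (loc r k))"

definition social_cost :: "nat \<Rightarrow> (nat \<Rightarrow> real) \<Rightarrow> profile \<Rightarrow> real \<Rightarrow> real" where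
  "social_cost n \<alpha> r y = (\<Sum>i\<in>agents n. cost n \<alpha> r i y)"

definition optimal_location :: "nat \<Rightarrow> (nat \<Rightarrow> real) \<Rightarrow> profile \<Rightarrow> real \<Rightarrow> bool" where
  "optimal_location n \<alpha> r y \<longleftrightarrow> is_arg_min (social_cost n \<alpha> r) (\<lambda>z. z \<in> {0..1}) y"

definition weight :: "nat \<Rightarrow> (nat \<Rightarrow> real) \<Rightarrow> profile \<Rightarrow> nat \<Rightarrow> real" where
  "weight n \<alpha> r i = 1 - \<alpha> (grp r i) * (real (card (members n r (grp r i))) - 1)"

definition left_agents :: "nat \<Rightarrow> profile \<Rightarrow> real \<Rightarrow> nat set" where
  "left_agents n r y = {i \<in> agents n. loc r i \<le> y}"

definition right_agents :: "nat \<Rightarrow> profile \<Rightarrow> real \<Rightarrow> nat set" where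
  "right_agents n r y = {i \<in> agents n. loc r i > y}"

definition Y1 :: "nat \<Rightarrow> (nat \<Rightarrow> real) \<Rightarrow> profile \<Rightarrow> real set" where
  "Y1 n \<alpha> r = {y \<in> {0..1}.
     (\<Sum>i\<in>left_agents n r y. weight n \<alpha> r i) < (\<Sum>i\<in>right_agents n r y. weight n \<alpha> r i)}"

definition Y2 :: "nat \<Rightarrow> (nat \<Rightarrow> real) \<Rightarrow> profile \<Rightarrow> real set" where
  "Y2 n \<alpha> r = {y \<in> {0..1}.
     (\<Sum>i\<in>left_agents n r y. weight n \<alpha> r i) > (\<Sum>i\<in>right_agents n r y. weight n \<alpha> r i)}"

text \<open>
  The supremum and infimum are those of the ordered set \<open>[0, 1]\<close>. They agree with the
  real ones on nonempty subsets of \<open>[0, 1]\<close>; the empty set has supremum 0 and infimum 1.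
\<close>

definition y_left :: "nat \<Rightarrow> (nat \<Rightarrow> real) \<Rightarrow> profile \<Rightarrow> real" where
  "y_left n \<alpha> r = (if Y1 n \<alpha> r = {} then 0 else Sup (Y1 n \<alpha> r))"

definition y_right :: "nat \<Rightarrow> (nat \<Rightarrow> real) \<Rightarrow> profile \<Rightarrow> real" where
  "y_right n \<alpha> r = (if Y2 n \<alpha> r = {} then 1 else Inf (Y2 n \<alpha> r))"

end

theory Submission
  imports Defs
begin

text \<open>
  Exchanging the order of summation in the externality terms shows that, up to a constant, the
  social cost is the weighted median objective \<open>f y = (\<Sum>i. w\<^sub>i * dist y x\<^sub>i)\<close>; the bounds on the
  externality factors make the weights nonnegative. The imbalance
  \<open>D y = sum w (L y) - sum w (R y)\<close> is then a subgradient of the convex function \<open>f\<close> at \<open>y\<close>.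
  Hence a minimiser has no point of \<open>Y\<^sub>1\<close> (where \<open>D < 0\<close>) to its right and no point of \<open>Y\<^sub>2\<close>
  (where \<open>D > 0\<close>) to its left, and conversely these two conditions make \<open>f\<close> monotone on either
  side of \<open>y\<close>.
\<close>

text \<open>The distance to agent \<open>k\<close> occurs once in the cost of \<open>k\<close> and,
  with factor \<open>- \<alpha> (grp r k)\<close>, in the cost of every other member of the group;
  together these give the coefficient \<open>weight n \<alpha> r k\<close>. The ones in the
  externality terms do not depend on \<open>y\<close> and form the second sum.\<close>

lemma social_cost_eq:
  "social_cost n \<alpha> r y =
     (\<Sum>i\<in>agents n. weight n \<alpha> r i * dist y (loc r i)) +
     (\<Sum>i\<in>agents n. \<alpha> (grp r i) * (real (card (members n r (grp r i))) - 1))"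
proof -
  have fin: "finite (agents n)"
    by (simp add: agents_def)
  have others: "(\<Sum>i\<in>{i \<in> agents n. k \<in> members n r (grp r i) - {i}}. \<alpha> (grp r i) * c)
      = \<alpha> (grp r k) * (real (card (members n r (grp r k))) - 1) * c"
    if k: "k \<in> agents n" for k and c :: real
  proof -
    \<comment> \<open>Being distinct members of one group is a symmetric relation.\<close>
    have eq: "{i \<in> agents n. k \<in> members n r (grp r i) - {i}} = members n r (grp r k) - {k}"
      using k by (auto simp: members_def)
    have "k \<in> members n r (grp r k)" "finite (members n r (grp r k))"
      using k fin by (auto simp: members_def)
    then have "real (card (members n r (grp r k) - {k})) = real (card (members n r (grp r k))) - 1"
      by (metis card.remove of_nat_Suc add_diff_cancel_left')
    moreover have "(\<Sum>i\<in>members n r (grp r k) - {k}. \<alpha> (grp r i) * c)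
        = (\<Sum>i\<in>members n r (grp r k) - {k}. \<alpha> (grp r k) * c)"
      by (rule sum.cong) (auto simp: members_def)
    ultimately show ?thesis
      unfolding eq by simp
  qed
  \<comment> \<open>Writing the inner sum as a restricted sum over all agents makes the two sums
    exchangeable.\<close>
  have "(\<Sum>i\<in>agents n. \<alpha> (grp r i) * (\<Sum>k\<in>members n r (grp r i) - {i}. 1 - dist y (loc r k)))
      = (\<Sum>i\<in>agents n. \<Sum>k\<in>{k \<in> agents n. k \<in> members n r (grp r i) - {i}}.
          \<alpha> (grp r i) * (1 - dist y (loc r k)))"
    unfolding sum_distrib_left
    by (intro sum.cong refl) (auto simp: members_def)
  also have "\<dots> = (\<Sum>k\<in>agents n. \<Sum>i\<in>{i \<in> agents n. k \<in> members n r (grp r i) - {i}}.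
          \<alpha> (grp r i) * (1 - dist y (loc r k)))"
    by (rule sum.swap_restrict[OF fin fin])
  also have "\<dots> = (\<Sum>k\<in>agents n.
      \<alpha> (grp r k) * (real (card (members n r (grp r k))) - 1) * (1 - dist y (loc r k)))"
    by (rule sum.cong[OF refl]) (rule others)
  finally have "social_cost n \<alpha> r y = (\<Sum>i\<in>agents n. dist y (loc r i) +
      \<alpha> (grp r i) * (real (card (members n r (grp r i))) - 1) * (1 - dist y (loc r i)))"
    by (simp only: social_cost_def cost_def sum.distrib)
  also have "\<dots> = (\<Sum>i\<in>agents n. weight n \<alpha> r i * dist y (loc r i) +
      \<alpha> (grp r i) * (real (card (members n r (grp r i))) - 1))"
    by (rule sum.cong) (simp_all add: weight_def algebra_simps)
  finally show ?thesis
    by (simp only: sum.distrib)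
qed

text \<open>The group of \<open>i\<close> contains \<open>i\<close>, so if it has at most one member
  it is a singleton and the weight is 1, whatever the factor.\<close>

lemma weight_nonneg:
  assumes "valid_profile n m r" "valid_factors n m r \<alpha>" "i \<in> agents n"
  shows "weight n \<alpha> r i \<ge> 0"
proof (cases "card (members n r (grp r i)) > 1")
  case True
  moreover have "grp r i \<in> {1..m}"
    using assms by (auto simp: valid_profile_def)
  ultimately have "\<alpha> (grp r i) \<le> 1 / (real (card (members n r (grp r i))) - 1)"
    using assms(2) by (auto simp: valid_factors_def)
  with True show ?thesis
    by (simp add: weight_def field_simps)
next
  case False
  moreover have "card (members n r (grp r i)) > 0"
    using assms(3) by (auto simp: card_gt_0_iff members_def agents_def)
  ultimately have "card (members n r (grp r i)) = 1"
    by linarith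
  then show ?thesis
    by (simp add: weight_def)
qed

text \<open>The slope of the distance to \<open>x i\<close> is 1 to the right of \<open>x i\<close>
  and -1 to its left. At the kink \<open>t = x i\<close> every number in [-1, 1] is a subgradient,
  so counting ties with slope 1 is harmless. Nonnegative weights preserve the inequality under
  summation.\<close>

lemma weighted_dist_subgradient:
  fixes x w :: "'a \<Rightarrow> real"
  assumes "finite A" "\<And>i. i \<in> A \<Longrightarrow> w i \<ge> 0"
  shows "(\<Sum>i\<in>A. w i * dist t (x i)) + (sum w {i \<in> A. x i \<le> t} - sum w {i \<in> A. x i > t}) * (z - t)
    \<le> (\<Sum>i\<in>A. w i * dist z (x i))"
proof -
  have "sum w {i \<in> A. x i \<le> t} - sum w {i \<in> A. x i > t}
      = (\<Sum>i\<in>A. w i * (if x i \<le> t then 1 else -1))"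
    using assms(1) by (simp add: sum.inter_filter sum_subtractf[symmetric])
      (rule sum.cong, auto)
  then have "(\<Sum>i\<in>A. w i * dist t (x i))
        + (sum w {i \<in> A. x i \<le> t} - sum w {i \<in> A. x i > t}) * (z - t)
      = (\<Sum>i\<in>A. w i * (dist t (x i) + (if x i \<le> t then 1 else -1) * (z - t)))"
    by (simp only: sum_distrib_right sum.distrib distrib_left mult.assoc)
  also have "\<dots> \<le> (\<Sum>i\<in>A. w i * dist z (x i))"
    by (intro sum_mono mult_left_mono assms(2)) (auto simp: dist_real_def)
  finally show ?thesis .
qed

lemma minimum_iff_subgradient_signs:
  fixes f D :: "real \<Rightarrow> real"
  assumes cont: "isCont f y" and y: "y \<in> {a..b}"
    and sub: "\<And>t z. f t + D t * (z - t) \<le> f z"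
  shows "(\<forall>z\<in>{a..b}. f y \<le> f z) \<longleftrightarrow>
    (\<forall>t\<in>{a..b}. D t < 0 \<longrightarrow> t \<le> y) \<and> (\<forall>t\<in>{a..b}. D t > 0 \<longrightarrow> y \<le> t)"
    (is "?min \<longleftrightarrow> ?signs")
proof
  assume min: ?min
  show ?signs
  proof (intro conjI ballI impI; rule ccontr)
    fix t assume t: "t \<in> {a..b}" "D t < 0" "\<not> t \<le> y"
    \<comment> \<open>By \<open>sub\<close>, this forces \<open>f t < f y\<close>.\<close>
    then have "D t * (y - t) > 0" by (simp add: mult_neg_neg)
    then show False using sub[of t y] min t(1) by fastforce
  next
    fix t assume t: "t \<in> {a..b}" "D t > 0" "\<not> y \<le> t"
    then have "D t * (y - t) > 0" by simp
    then show False using sub[of t y] min t(1) by fastforce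
  qed
next
  assume signs: ?signs
  show ?min
  proof
    fix z assume z: "z \<in> {a..b}"
    consider "z = y" | "y < z" | "z < y" by linarith
    then show "f y \<le> f z"
    proof cases
      case 2
      \<comment> \<open>The sign conditions say nothing about \<open>D y\<close>, so the subgradient
        is taken at points strictly between \<open>y\<close> and \<open>z\<close>; continuity then
        carries the bound to \<open>y\<close>.\<close>
      have "f t \<le> f z" if "t \<in> {y<..<z}" for t
      proof -
        have "t \<in> {a..b}" using that y z by auto
        then have "D t \<ge> 0" using signs that by (meson greaterThanLessThan_iff not_le)
        then have "D t * (z - t) \<ge> 0" using that by simp
        then show ?thesis using sub[of t z] by simp
      qed
      then have "\<forall>\<^sub>F t in at_right y. f t \<le> f z"
        using 2 by (auto simp: eventually_at_right)
      moreover have "(f \<longlongrightarrow> f y) (at_right y)"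
        using cont by (simp add: isCont_def filterlim_at_split)
      ultimately show ?thesis
        by (intro tendsto_upperbound) auto
    next
      case 3
      have "f t \<le> f z" if "t \<in> {z<..<y}" for t
      proof -
        have "t \<in> {a..b}" using that y z by auto
        then have "D t \<le> 0" using signs that by (meson greaterThanLessThan_iff not_le)
        then have "D t * (z - t) \<ge> 0" using that by (simp add: mult_nonpos_nonpos)
        then show ?thesis using sub[of t z] by simp
      qed
      then have "\<forall>\<^sub>F t in at_left y. f t \<le> f z"
        using 3 by (auto simp: eventually_at_left)
      moreover have "(f \<longlongrightarrow> f y) (at_left y)"
        using cont by (simp add: isCont_def filterlim_at_split)
      ultimately show ?thesis
        by (intro tendsto_upperbound) auto
    qed simp
  qed
qed

text \<open>If \<open>Y1\<close> is empty, the default 0 lies below \<open>y\<close> and both sides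
  hold. The default 1 does the same for \<open>Y2\<close> below.\<close>

lemma y_left_le_iff:
  assumes "y \<in> {0..1}"
  shows "y_left n \<alpha> r \<le> y \<longleftrightarrow> (\<forall>t\<in>Y1 n \<alpha> r. t \<le> y)"
proof -
  have "bdd_above (Y1 n \<alpha> r)"
    by (rule bdd_aboveI[of _ 1]) (auto simp: Y1_def)
  then show ?thesis
    using assms by (simp add: y_left_def cSup_le_iff)
qed

lemma le_y_right_iff:
  assumes "y \<in> {0..1}"
  shows "y \<le> y_right n \<alpha> r \<longleftrightarrow> (\<forall>t\<in>Y2 n \<alpha> r. y \<le> t)"
proof -
  have "bdd_below (Y2 n \<alpha> r)"
    by (rule bdd_belowI[of _ 0]) (auto simp: Y2_def)
  then show ?thesis
    using assms by (simp add: y_right_def le_cInf_iff)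
qed

theorem proposition2:
  fixes n m :: nat and r :: profile and \<alpha> :: "nat \<Rightarrow> real" and y :: real
  assumes "valid_profile n m r"
    and "valid_factors n m r \<alpha>"
    and "y \<in> {0..1}"
  shows "optimal_location n \<alpha> r y \<longleftrightarrow> y \<in> {y_left n \<alpha> r..y_right n \<alpha> r}"
proof -
  define f where "f y = (\<Sum>i\<in>agents n. weight n \<alpha> r i * dist y (loc r i))" for y
  define D where "D t = sum (weight n \<alpha> r) (left_agents n r t)
    - sum (weight n \<alpha> r) (right_agents n r t)" for t
  \<comment> \<open>The constant part of the social cost cancels when two locations are
    compared.\<close>
  have "optimal_location n \<alpha> r y \<longleftrightarrow> (\<forall>z\<in>{0..1}. f y \<le> f z)"
    using assms(3)
    by (auto simp: optimal_location_def is_arg_min_def social_cost_eq f_def not_less)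
  also have "\<dots> \<longleftrightarrow>
      (\<forall>t\<in>{0..1}. D t < 0 \<longrightarrow> t \<le> y) \<and> (\<forall>t\<in>{0..1}. D t > 0 \<longrightarrow> y \<le> t)"
  proof (rule minimum_iff_subgradient_signs[OF _ assms(3)])
    show "isCont f y"
      unfolding f_def by (intro continuous_intros)
    show "f t + D t * (z - t) \<le> f z" for t z
      unfolding f_def D_def left_agents_def right_agents_def
      by (rule weighted_dist_subgradient)
        (use weight_nonneg[OF assms(1,2)] in \<open>auto simp: agents_def\<close>)
  qed
  also have "\<dots> \<longleftrightarrow> (\<forall>t\<in>Y1 n \<alpha> r. t \<le> y) \<and> (\<forall>t\<in>Y2 n \<alpha> r. y \<le> t)"
    by (auto simp: Y1_def Y2_def D_def)
  also have "\<dots> \<longleftrightarrow> y \<in> {y_left n \<alpha> r..y_right n \<alpha> r}"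
    using assms(3) by (simp add: y_left_le_iff le_y_right_iff)
  finally show ?thesis .
qed

end
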